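(* Let $q\ge 1$ and $c\ge 1$ be integers. The parameters $(q,c)$ are feasible for an SRNT graph if and only if $1\le c\le q(q+1)$ and the rational numbers $$\alpha=\frac{q^4-q^2}{c}\qquad\text{and}\qquad \beta=\frac{q(q+1)(q+2)(q+3)}{c+2q}$$ are integers having the same parity.
   Context: An SRNT graph (strongly regular graph with no triangles) is a regular graph of degree $k$ in which any two adjacent vertices have no common neighbours and any two distinct non-adjacent vertices have exactly $c$ common neighbours, with $k\ge 3$ and $k>c\ge 1$. Its parameters are expressed by the pair $(q,c)$, where $q$ is the second largest eigenvalue of the adjacency matrix, a positive integer. A pair $(q,c)$ of positive integers is called feasible (for an SRNT graph) if $1\le c\le q(q+1)$ and the following two conditions hold: (i) $c$ divides $q^4-q^2$; (ii) $c+2q$ divides the integer $q^4+3q^3+5q^2+3q+q\,(q^4-q^2)/c$. (Feasibility is a purely arithmetic condition; it does not assert that a graph exists.) *)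

theory Defs
  imports Complex_Main
begin

text \<open>
  Feasibility is a purely arithmetic condition on the parameters; it does not assert that a
  strongly regular graph without triangles with these parameters exists. The quotient
  \<open>(q^4 - q^2) div c\<close> is exact because of the preceding conjunct.
\<close>

definition srnt_feasible :: "int \<Rightarrow> int \<Rightarrow> bool" where
  "srnt_feasible q c \<longleftrightarrow>
     1 \<le> q \<and> 1 \<le> c \<and> c \<le> q * (q + 1) \<and>
     c dvd q^4 - q^2 \<and>
     c + 2 * q dvd q^4 + 3 * q^3 + 5 * q^2 + 3 * q + q * ((q^4 - q^2) div c)"

definition srnt_alpha :: "int \<Rightarrow> int \<Rightarrow> rat" where
  "srnt_alpha q c = of_int (q^4 - q^2) / of_int c"

definition srnt_beta :: "int \<Rightarrow> int \<Rightarrow> rat" where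
  "srnt_beta q c = of_int (q * (q + 1) * (q + 2) * (q + 3)) / of_int (c + 2 * q)"

end

theory Submission
  imports Defs
begin

text \<open>
  Put \<open>d = c + 2 * q\<close>, let \<open>N\<close> be the integer that \<open>d\<close> has to divide in a feasible pair, and let
  \<open>P = q * (q + 1) * (q + 2) * (q + 3)\<close>. Once \<open>\<alpha>\<close> is an integer \<open>a\<close>, so that
  \<open>q^4 - q^2 = a * c\<close>, one has \<open>2 * N = P + a * d\<close>. Hence \<open>d\<close> divides \<open>N\<close>, with quotient \<open>m\<close>,
  precisely when \<open>P = (2 * m - a) * d\<close>, that is, when \<open>\<beta> = 2 * m - a\<close> is an integer of the same
  parity as \<open>a\<close>. The parity condition thus accounts for the factor 2 in the identity.
\<close>

lemma of_int_divide_eq_of_int_iff: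
  fixes x y a :: int
  assumes "y \<noteq> 0"
  shows "(of_int x / of_int y :: rat) = of_int a \<longleftrightarrow> x = a * y"
proof -
  have "(of_int x / of_int y :: rat) = of_int a \<longleftrightarrow> (of_int x :: rat) = of_int (a * y)"
    using assms by (simp add: divide_eq_eq)
  then show ?thesis
    by (simp only: of_int_eq_iff)
qed

text \<open>
  If \<open>2 * N\<close> and \<open>P\<close> differ by \<open>a * d\<close>, then a quotient \<open>m\<close> of \<open>N\<close> by \<open>d\<close> and a quotient \<open>b\<close> of
  \<open>P\<close> by \<open>d\<close> determine each other through \<open>2 * m = a + b\<close>.
\<close>

lemma dvd_iff_quotient_same_parity:
  fixes N P a d :: int
  assumes "2 * N = P + a * d"
  shows "d dvd N \<longleftrightarrow> (\<exists>b. P = b * d \<and> (even a \<longleftrightarrow> even b))"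
proof
  assume "d dvd N"
  then obtain m where "N = d * m" ..
  then have "P = (2 * m - a) * d"
    using assms by (simp add: algebra_simps)
  moreover have "even a \<longleftrightarrow> even (2 * m - a)"
    by simp
  ultimately show "\<exists>b. P = b * d \<and> (even a \<longleftrightarrow> even b)"
    by blast
next
  assume "\<exists>b. P = b * d \<and> (even a \<longleftrightarrow> even b)"
  then obtain b where b: "P = b * d" and even_sum: "even (a + b)"
    by auto
  from even_sum obtain m where "a + b = 2 * m" ..
  moreover have "2 * N = (a + b) * d"
    using assms b by (simp add: algebra_simps)
  ultimately have "N = d * m"
    by simp
  then show "d dvd N" ..
qed

lemma srnt_key_identity:
  fixes q c a :: int
  assumes "q^4 - q^2 = a * c"
  shows "2 * (q^4 + 3 * q^3 + 5 * q^2 + 3 * q + q * a) =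
    q * (q + 1) * (q + 2) * (q + 3) + a * (c + 2 * q)"
proof -
  have "q * (q + 1) * (q + 2) * (q + 3) = q^4 + 6 * q^3 + 11 * q^2 + 6 * q"
    by (simp add: algebra_simps power4_eq_xxxx power3_eq_cube power2_eq_square)
  then show ?thesis
    using assms by (simp add: algebra_simps)
qed

theorem theorem1:
  fixes q c :: int
  assumes "1 \<le> q" and "1 \<le> c"
  shows "srnt_feasible q c \<longleftrightarrow>
    1 \<le> c \<and> c \<le> q * (q + 1) \<and>
    (\<exists>a b :: int. srnt_alpha q c = of_int a \<and> srnt_beta q c = of_int b \<and> (even a \<longleftrightarrow> even b))"
proof -
  let ?N = "\<lambda>a. q^4 + 3 * q^3 + 5 * q^2 + 3 * q + q * a"
  let ?P = "q * (q + 1) * (q + 2) * (q + 3)"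
  have c: "c \<noteq> 0" and d: "c + 2 * q \<noteq> 0"
    using assms by auto
  have alpha: "srnt_alpha q c = of_int a \<longleftrightarrow> q^4 - q^2 = a * c" for a
    unfolding srnt_alpha_def using c by (rule of_int_divide_eq_of_int_iff)
  have beta: "srnt_beta q c = of_int b \<longleftrightarrow> ?P = b * (c + 2 * q)" for b
    unfolding srnt_beta_def using d by (rule of_int_divide_eq_of_int_iff)
  have "(c dvd q^4 - q^2 \<and> c + 2 * q dvd ?N ((q^4 - q^2) div c)) \<longleftrightarrow>
    (\<exists>a. q^4 - q^2 = a * c \<and> c + 2 * q dvd ?N a)"
    using c by (auto simp: dvd_def mult.commute)
  also have "\<dots> \<longleftrightarrow> (\<exists>a. q^4 - q^2 = a * c \<and>
    (\<exists>b. ?P = b * (c + 2 * q) \<and> (even a \<longleftrightarrow> even b)))"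
    using dvd_iff_quotient_same_parity[OF srnt_key_identity] by blast
  also have "\<dots> \<longleftrightarrow> (\<exists>a b :: int. srnt_alpha q c = of_int a \<and> srnt_beta q c = of_int b \<and>
    (even a \<longleftrightarrow> even b))"
    unfolding alpha beta by blast
  finally show ?thesis
    unfolding srnt_feasible_def using assms by blast
qed

end
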